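(* Let $M$ be a matroid on a finite set $X$ with family of independent sets $\mathcal{I}$, and let $P_M=\operatorname{conv}\{e_A : A\in\mathcal{I}\}\subseteq\mathbb{R}^X$ be its independence polytope (whose vertices are the $e_A$, $A\in\mathcal{I}$). Two distinct vertices $e_A$ and $e_B$ of $P_M$ form an edge of $P_M$ if and only if there is a unique way to write $e_A+e_B$ as the sum of two vertices of $P_M$, i.e., for all $C,D\in\mathcal{I}$, $e_A+e_B=e_C+e_D$ implies $\{A,B\}=\{C,D\}$.
   Context: For a finite set $X$, $\mathbb{R}^X$ denotes the real vector space with standard basis $\{e_x : x\in X\}$, and for $A\subseteq X$ the indicator vector is $e_A=\sum_{a\in A}e_a$. A matroid on $X$ is a nonempty family $\mathcal{I}$ of subsets of $X$ (the independent sets) with $\emptyset\in\mathcal{I}$, closed under taking subsets, and such that if $A,B\in\mathcal{I}$ with $|B|>|A|$ then there is $b\in B\setminus A$ with $A\cup\{b\}\in\mathcal{I}$. *)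

theory Defs
  imports "HOL-Analysis.Analysis"
begin

locale matroid =
  fixes X :: "'x set" and \<I> :: "'x set set"
  assumes finite_ground: "finite X"
    and indep_subset_ground: "A \<in> \<I> \<Longrightarrow> A \<subseteq> X"
    and empty_indep: "{} \<in> \<I>"
    and indep_subset: "A \<in> \<I> \<Longrightarrow> B \<subseteq> A \<Longrightarrow> B \<in> \<I>"
    and augment: "A \<in> \<I> \<Longrightarrow> B \<in> \<I> \<Longrightarrow> card B > card A \<Longrightarrow> \<exists>b \<in> B - A. A \<union> {b} \<in> \<I>"

definition indicator_vec :: "'x::finite set \<Rightarrow> real ^ 'x" where
  "indicator_vec A = (\<Sum>a\<in>A. axis a 1)"

definition independence_polytope :: "'x::finite set set \<Rightarrow> (real ^ 'x) set" where
  "independence_polytope \<I> = convex hull (indicator_vec ` \<I>)"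

end

theory Submission
  imports Defs
begin

text \<open>
  An alternative decomposition of \<open>e\<^sub>A + e\<^sub>B\<close> represents the midpoint of the segment by points
  outside it, so it prevents the segment from being a face. Conversely, augmentation (if the
  cardinalities differ) or symmetric exchange (if they agree) always yields a second decomposition
  unless \<open>B = A + b\<close>, or \<open>A = S + a\<close> and \<open>B = S + b\<close> with \<open>S + a + b\<close> dependent. In these two cases
  an explicit linear functional is maximized over the vertices exactly at \<open>e\<^sub>A\<close> and \<open>e\<^sub>B\<close>.
\<close>

section \<open>Indicator vectors and faces cut out by supporting hyperplanes\<close>

lemma indicator_vec_nth: "indicator_vec A $ i = (if i \<in> A then 1 else 0)"
proof -
  have "indicator_vec A $ i = (\<Sum>a\<in>A. if i = a then 1 else 0)"
    by (simp add: indicator_vec_def axis_def)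
  then show ?thesis by simp
qed

lemma indicator_vec_eq_iff: "indicator_vec A = indicator_vec B \<longleftrightarrow> A = B"
  by (auto simp: vec_eq_iff indicator_vec_nth split: if_splits)

lemma inner_indicator_vec: "w \<bullet> indicator_vec A = (\<Sum>a\<in>A. w $ a)"
  by (simp add: indicator_vec_def inner_sum_right inner_axis)

text \<open>\<open>affine hull T\<close> stays in the hyperplane where \<open>w\<close> has value
  \<open>m\<close>, and \<open>convex hull (S - T)\<close> stays strictly below it; their
  disjointness is the criterion of \<open>face_of_convex_hulls\<close>.\<close>

lemma face_of_convex_hull_supporting:
  fixes S :: "'a::euclidean_space set"
  assumes "finite S" "T \<subseteq> S"
    and eq: "\<And>x. x \<in> T \<Longrightarrow> w \<bullet> x = m" and less: "\<And>x. x \<in> S - T \<Longrightarrow> w \<bullet> x < m"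
  shows "convex hull T face_of convex hull S"
proof (rule face_of_convex_hulls[OF assms(1,2)])
  have "affine hull T \<subseteq> {x. w \<bullet> x = m}"
    by (rule hull_minimal) (use eq in \<open>auto simp: affine_hyperplane\<close>)
  moreover have "convex hull (S - T) \<subseteq> {x. w \<bullet> x < m}"
    by (rule hull_minimal) (use less in \<open>auto simp: convex_halfspace_lt\<close>)
  ultimately show "affine hull T \<inter> convex hull (S - T) = {}" by force
qed

lemma face_of_independence_polytope:
  fixes w :: "real ^ 'x::finite"
  assumes "\<J> \<subseteq> \<I>" "\<And>C. C \<in> \<J> \<Longrightarrow> (\<Sum>i\<in>C. w $ i) = m"
    and "\<And>C. C \<in> \<I> - \<J> \<Longrightarrow> (\<Sum>i\<in>C. w $ i) < m"
  shows "convex hull (indicator_vec ` \<J>) face_of independence_polytope \<I>"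
  unfolding independence_polytope_def
proof (rule face_of_convex_hull_supporting[where w = w and m = m])
  show "finite (indicator_vec ` \<I>)" by simp
qed (use assms in \<open>auto simp: inner_indicator_vec image_iff\<close>)

text \<open>Weights 1 on \<open>A\<close>, 0 on \<open>B - A\<close> and -1 outside \<open>B\<close>
  give the value \<open>card A\<close> exactly to the sets in the interval and less to all others.
  The case \<open>B = A\<close> serves for vertices, the case \<open>B = insert b A\<close> for
  edges.\<close>

lemma interval_face:
  fixes \<I> :: "'x::finite set set"
  assumes "A \<subseteq> B"
  shows "convex hull (indicator_vec ` {C \<in> \<I>. A \<subseteq> C \<and> C \<subseteq> B}) face_of independence_polytope \<I>"
proof -
  define w :: "real ^ 'x" where "w = (\<chi> i. if i \<in> A then 1 else if i \<in> B then 0 else -1)"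
  have sum: "(\<Sum>i\<in>C. w $ i) = real (card (A \<inter> C)) - real (card (C - B))" for C
  proof -
    have "(\<Sum>i\<in>C. w $ i) = (\<Sum>i\<in>C. (if i \<in> A then 1 else 0) - (if i \<in> - B then 1 else 0))"
      using assms by (intro sum.cong) (auto simp: w_def)
    also have "\<dots> = real (card (C \<inter> A)) - real (card (C \<inter> - B))"
      by (simp add: sum_subtractf sum.If_cases del: Compl_iff)
    finally show ?thesis by (simp add: Int_commute Diff_eq)
  qed
  show ?thesis
  proof (rule face_of_independence_polytope[where w = w and m = "real (card A)"])
    fix C assume "C \<in> {C \<in> \<I>. A \<subseteq> C \<and> C \<subseteq> B}"
    then have "A \<inter> C = A" "C - B = {}" by auto
    then show "(\<Sum>i\<in>C. w $ i) = real (card A)" by (simp only: sum) simp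
  next
    fix C assume "C \<in> \<I> - {C \<in> \<I>. A \<subseteq> C \<and> C \<subseteq> B}"
    then have "A \<inter> C \<subset> A \<or> C - B \<noteq> {}" by auto
    then have "card (A \<inter> C) < card A \<or> card (C - B) > 0"
      by (metis card_gt_0_iff finite psubset_card_mono)
    moreover have "card (A \<inter> C) \<le> card A" by (simp add: card_mono)
    ultimately show "(\<Sum>i\<in>C. w $ i) < real (card A)" by (auto simp: sum)
  qed auto
qed

lemma exchange_face:
  fixes \<I> :: "'x::finite set set"
  assumes "insert a S \<in> \<I>" "insert b S \<in> \<I>" and ab: "a \<notin> S" "b \<notin> S" "a \<noteq> b"
    and dep: "\<And>C. C \<in> \<I> \<Longrightarrow> insert a (insert b S) \<subseteq> C \<Longrightarrow> False"
  shows "convex hull (indicator_vec ` {insert a S, insert b S}) face_of independence_polytope \<I>"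
proof -
  \<comment> \<open>Weight 2 makes the loss of an element of \<open>S\<close> outweigh the surplus
    of 1 from having both \<open>a\<close> and \<open>b\<close>. With weight 1 on \<open>S\<close>,
    a set \<open>insert a (insert b (S - {s}))\<close> with \<open>s\<close> in \<open>S\<close>
    would tie with the two endpoints.\<close>
  define w :: "real ^ 'x" where "w = (\<chi> i. if i \<in> S then 2 else if i \<in> {a, b} then 1 else -1)"
  have sum: "(\<Sum>i\<in>C. w $ i) = 2 * real (card (S \<inter> C)) + (if a \<in> C then 1 else 0)
      + (if b \<in> C then 1 else 0) - real (card (C - insert a (insert b S)))" for C
  proof -
    have "(\<Sum>i\<in>C. w $ i) = (\<Sum>i\<in>C. 2 * (if i \<in> S then 1 else 0) + (if i = a then 1 else 0)
        + (if i = b then 1 else 0) - (if i \<in> - insert a (insert b S) then 1 else 0))"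
      using ab by (intro sum.cong) (auto simp: w_def)
    also have "\<dots> = 2 * real (card (C \<inter> S)) + (if a \<in> C then 1 else 0)
        + (if b \<in> C then 1 else 0) - real (card (C \<inter> - insert a (insert b S)))"
      by (simp only: sum_subtractf sum.distrib flip: sum_distrib_left)
         (simp add: sum.If_cases del: Compl_iff)
    finally show ?thesis by (simp add: Int_commute Diff_eq)
  qed
  show ?thesis
  proof (rule face_of_independence_polytope[where w = w and m = "2 * real (card S) + 1"])
    fix C assume C: "C \<in> {insert a S, insert b S}"
    then have "S \<inter> C = S" "C - insert a (insert b S) = {}" by auto
    then show "(\<Sum>i\<in>C. w $ i) = 2 * real (card S) + 1"
      using C ab by (simp only: sum) auto
  next
    fix C assume C: "C \<in> \<I> - {insert a S, insert b S}"
    let ?R = "C - insert a (insert b S)"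
    have less: "card (S \<inter> C) < card S" if "\<not> S \<subseteq> C"
      using that by (intro psubset_card_mono) auto
    have le: "card (S \<inter> C) \<le> card S" by (simp add: card_mono)
    \<comment> \<open>The remaining combination, \<open>S\<close> together with both
      \<open>a\<close> and \<open>b\<close> inside \<open>C\<close>, is ruled out by
      \<open>dep\<close>.\<close>
    consider "\<not> S \<subseteq> C" | "S \<subseteq> C" "a \<notin> C" "b \<notin> C" | "S \<subseteq> C" "a \<in> C \<longleftrightarrow> b \<notin> C"
      using dep C by auto
    then show "(\<Sum>i\<in>C. w $ i) < 2 * real (card S) + 1"
    proof cases
      case 1
      then show ?thesis using less by (auto simp: sum)
    next
      case 2
      then show ?thesis using le by (auto simp: sum)
    next
      case 3
      \<comment> \<open>Without an element outside \<open>insert a (insert b S)\<close>, the set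
        \<open>C\<close> would be one of the two endpoints; such an element costs 1.\<close>
      then have "?R \<noteq> {}" using C by auto
      then have "card ?R > 0" by (simp add: card_gt_0_iff)
      then show ?thesis using le 3 by (auto simp: sum)
    qed
  qed (use assms in auto)
qed

section \<open>Augmentation and symmetric exchange in a matroid\<close>

context matroid
begin

lemma finite_indep: "A \<in> \<I> \<Longrightarrow> finite A"
  using finite_ground indep_subset_ground finite_subset by metis

text \<open>Augmentation from \<open>B\<close> is iterated; the induction is on the number of
  elements still missing.\<close>

lemma extend_within:
  assumes "T \<in> \<I>" "B \<in> \<I>" "card T \<le> card B"
  obtains J where "J \<in> \<I>" "T \<subseteq> J" "J \<subseteq> T \<union> B" "card J = card B"
proof -
  have "\<exists>J\<in>\<I>. T \<subseteq> J \<and> J \<subseteq> T \<union> B \<and> card J = card B"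
    using assms
  proof (induction "card B - card T" arbitrary: T)
    case 0
    then show ?case by auto
  next
    case (Suc n)
    then have "card T < card B" by linarith
    then obtain b where b: "b \<in> B - T" "T \<union> {b} \<in> \<I>"
      using augment[OF Suc.prems(1,2)] by blast
    have c: "card (T \<union> {b}) = Suc (card T)"
      using b finite_indep[OF Suc.prems(1)] by simp
    have "\<exists>J\<in>\<I>. T \<union> {b} \<subseteq> J \<and> J \<subseteq> (T \<union> {b}) \<union> B \<and> card J = card B"
      using Suc.hyps(2) b c Suc.prems by (intro Suc.hyps(1)) auto
    then show ?case using b by blast
  qed
  then show thesis using that by blast
qed

text \<open>This is the classical exchange for bases, but \<open>A\<close> and \<open>B\<close> need
  only have equal size, so \<open>insert a B\<close> may be independent. If it is not, consider the
  fundamental circuit of \<open>a\<close> over \<open>B\<close>: were none of its elements other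
  than \<open>a\<close> able to extend \<open>A - {a}\<close>, then \<open>A - {a}\<close> would
  span them and hence \<open>a\<close>, against the independence of \<open>A\<close>.\<close>

lemma symmetric_exchange:
  assumes A: "A \<in> \<I>" and B: "B \<in> \<I>" and card: "card A = card B" and a: "a \<in> A - B"
  obtains b where "b \<in> B - A" "insert b (A - {a}) \<in> \<I>" "insert a (B - {b}) \<in> \<I>"
proof -
  have fin: "finite A" "finite B" using A B finite_indep by auto
  have Aa: "A - {a} \<in> \<I>" using A indep_subset by blast
  have cA: "card A = Suc (card (A - {a}))" using a fin by (simp add: card_Suc_Diff1 del: card_Diff_insert)
  have "\<exists>b\<in>B - A. insert b (A - {a}) \<in> \<I> \<and> insert a (B - {b}) \<in> \<I>"
  proof (cases "insert a B \<in> \<I>")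
    case True
    obtain b where "b \<in> B - (A - {a})" "insert b (A - {a}) \<in> \<I>"
      using augment[OF Aa B] card cA by auto
    moreover have "insert a (B - {b}) \<in> \<I>" using True by (rule indep_subset) auto
    ultimately show ?thesis using a by blast
  next
    case dep: False
    \<comment> \<open>The set \<open>insert a T\<close> is the fundamental circuit of \<open>a\<close> over \<open>B\<close>.\<close>
    define T where "T = {b \<in> B. insert a (B - {b}) \<in> \<I>}"
    have T: "T \<in> \<I>" using B by (rule indep_subset) (auto simp: T_def)
    have T_dep: "insert a T \<notin> \<I>"
    proof
      assume ind: "insert a T \<in> \<I>"
      have "T \<noteq> B" using ind dep by auto
      then have "T \<subset> B" by (auto simp: T_def)
      then have "card T < card B" using fin by (simp add: psubset_card_mono)
      then have "card (insert a T) \<le> card B"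
        using finite_indep[OF T] by (simp add: card_insert_if)
      from extend_within[OF ind B this] obtain J where
        J: "J \<in> \<I>" "insert a T \<subseteq> J" "J \<subseteq> insert a T \<union> B" "card J = card B" by blast
      \<comment> \<open>\<open>J\<close> misses some \<open>b\<close> of \<open>B\<close>, and
        counting forces \<open>J = insert a (B - {b})\<close>. This puts \<open>b\<close> into
        \<open>T\<close>, which lies in \<open>J\<close>.\<close>
      have "\<not> B \<subseteq> J"
      proof
        assume "B \<subseteq> J"
        then have "insert a B \<subseteq> J" using J by auto
        then show False using dep J indep_subset by blast
      qed
      then obtain b where b: "b \<in> B" "b \<notin> J" by auto
      have sub: "J \<subseteq> insert a (B - {b})" using J b by (auto simp: T_def)
      have "card (insert a (B - {b})) = card B"
        using a b fin card.remove[of B b] by simp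
      then have "J = insert a (B - {b})"
        using sub J fin by (intro card_subset_eq) auto
      then have "b \<in> T" using J b by (auto simp: T_def)
      then show False using J b by auto
    qed
    show ?thesis
    proof (rule ccontr)
      assume contr: "\<not> ?thesis"
      have aT: "a \<notin> T" using a by (auto simp: T_def)
      \<comment> \<open>By \<open>contr\<close> no element of \<open>T\<close> extends
        \<open>A - {a}\<close>, so \<open>A - {a}\<close> has maximum size among the independent
        subsets of \<open>(A - {a}) \<union> T\<close>.\<close>
      have maximal: False if K: "K \<in> \<I>" "K \<subseteq> (A - {a}) \<union> T" "card K > card (A - {a})" for K
      proof -
        obtain y where y: "y \<in> K - (A - {a})" "insert y (A - {a}) \<in> \<I>"
          using augment[OF Aa K(1,3)] by auto
        then have "y \<in> T" using K by auto
        then show False using y contr a aT by (auto simp: T_def)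
      qed
      have "card T \<le> card (A - {a})" using maximal[OF T] by fastforce
      from extend_within[OF T Aa this] obtain J where
        J: "J \<in> \<I>" "T \<subseteq> J" "J \<subseteq> T \<union> (A - {a})" "card J = card (A - {a})" by blast
      \<comment> \<open>\<open>J\<close> is one element smaller than \<open>A\<close>. Adding
        \<open>a\<close> to it would make \<open>insert a T\<close> independent; adding any other
        element of \<open>A\<close> would contradict \<open>maximal\<close>.\<close>
      obtain x where x: "x \<in> A - J" "insert x J \<in> \<I>"
        using augment[OF J(1) A] J cA by auto
      show False
      proof (cases "x = a")
        case True
        then have "insert a T \<in> \<I>" using x(2) J(2) indep_subset by blast
        then show False using T_dep by simp
      next
        case False
        have "card (insert x J) > card (A - {a})"
          using x J finite_indep[OF J(1)] by simp
        then show False using maximal[OF x(2)] False x J by blast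
      qed
    qed
  qed
  then show thesis using that by blast
qed

end

section \<open>Vertices and edges of the polytope\<close>

lemma extreme_points_independence_polytope:
  fixes \<I> :: "'x::finite set set"
  shows "{v. v extreme_point_of independence_polytope \<I>} = indicator_vec ` \<I>"
proof (rule set_eqI, rule iffI)
  fix v assume "v \<in> {v. v extreme_point_of independence_polytope \<I>}"
  then show "v \<in> indicator_vec ` \<I>"
    unfolding independence_polytope_def using extreme_point_of_convex_hull by blast
next
  fix v :: "real ^ 'x" assume "v \<in> indicator_vec ` \<I>"
  then obtain A where A: "A \<in> \<I>" "v = indicator_vec A" by auto
  \<comment> \<open>The degenerate interval from \<open>A\<close> to \<open>A\<close> turns
    \<open>interval_face\<close> into a statement about a single point.\<close>
  then have "{C \<in> \<I>. A \<subseteq> C \<and> C \<subseteq> A} = {A}" by auto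
  then have "{v} face_of independence_polytope \<I>"
    using interval_face[of A A \<I>] A by simp
  then show "v \<in> {v. v extreme_point_of independence_polytope \<I>}"
    by (simp add: face_of_singleton)
qed

lemma edge_imp_unique_decomposition:
  fixes \<I> :: "'x::finite set set"
  assumes edge: "closed_segment (indicator_vec A) (indicator_vec B) edge_of independence_polytope \<I>"
    and C: "C \<in> \<I>" and D: "D \<in> \<I>"
    and eq: "indicator_vec A + indicator_vec B = indicator_vec C + indicator_vec D"
  shows "{A, B} = {C, D}"
proof (cases "C = D")
  case True
  \<comment> \<open>Each coordinate of the right-hand side is 0 or 2, which determines both summands
    on the left.\<close>
  have "(i \<in> A \<longleftrightarrow> i \<in> C) \<and> (i \<in> B \<longleftrightarrow> i \<in> C)" for i
    using arg_cong[OF eq, of "\<lambda>v. v $ i"] True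
    by (auto simp: indicator_vec_nth split: if_splits)
  then show ?thesis using True by auto
next
  case False
  let ?P = "independence_polytope \<I>" and ?e = "indicator_vec :: 'x set \<Rightarrow> _"
  let ?S = "closed_segment (?e A) (?e B)"
  have face: "?S face_of ?P" using edge by (simp add: edge_of_def)
  have vertex: "?e K extreme_point_of ?P" if "K \<in> \<I>" for K
    using that extreme_points_independence_polytope[of \<I>] by auto
  have mid: "midpoint (?e C) (?e D) = midpoint (?e A) (?e B)"
    using eq by (simp add: midpoint_def)
  have "midpoint (?e C) (?e D) \<in> open_segment (?e C) (?e D)"
    using False by (simp add: indicator_vec_eq_iff)
  moreover have "midpoint (?e C) (?e D) \<in> ?S"
    unfolding mid by simp
  moreover have "?e C \<in> ?P" "?e D \<in> ?P"
    using vertex C D by (auto simp: extreme_point_of_def)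
  ultimately have in_S: "?e C \<in> ?S" "?e D \<in> ?S"
    using face_ofD[OF face] by blast+
  \<comment> \<open>A vertex of the polytope lying in a face is extreme in that face, and a segment
    has no extreme points but its ends.\<close>
  have end_point: "K = A \<or> K = B" if "K \<in> \<I>" "?e K \<in> ?S" for K
  proof -
    have "?e K extreme_point_of ?S"
      using extreme_point_of_face[OF face] vertex that by auto
    then show ?thesis by (simp add: extreme_point_of_segment indicator_vec_eq_iff)
  qed
  then have "C = A \<or> C = B" "D = A \<or> D = B" using in_S C D by auto
  then show ?thesis using False by auto
qed

text \<open>\<open>uniq\<close> is the decomposition condition in set form. Moving or swapping
  elements of \<open>A - B\<close> and \<open>B - A\<close> preserves union and intersection, so
  every such move that stays independent must return the original pair.\<close>

lemma (in matroid) unique_decomposition_cases: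
  fixes A B
  assumes A: "A \<in> \<I>" and B: "B \<in> \<I>" and "A \<noteq> B" and le: "card A \<le> card B"
    and uniq: "\<And>C D. C \<in> \<I> \<Longrightarrow> D \<in> \<I> \<Longrightarrow> C \<union> D = A \<union> B \<Longrightarrow> C \<inter> D = A \<inter> B \<Longrightarrow> {A, B} = {C, D}"
  obtains (augmentation) b where "b \<notin> A" "B = insert b A"
  | (exchange) S a b where "a \<notin> S" "b \<notin> S" "a \<noteq> b" "A = insert a S" "B = insert b S"
      "insert a (insert b S) \<notin> \<I>"
proof (cases "card A < card B")
  case True
  then obtain b where b: "b \<in> B - A" "insert b A \<in> \<I>"
    using augment[OF A B] by auto
  \<comment> \<open>Moving \<open>b\<close> from \<open>B\<close> to \<open>A\<close> must merely
    interchange the two sets, since \<open>insert b A\<close> differs from \<open>A\<close>.\<close>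
  have "{A, B} = {insert b A, B - {b}}"
    using b indep_subset[OF B] by (intro uniq) auto
  then have "B = insert b A" using b by (auto simp: doubleton_eq_iff)
  then show thesis using b augmentation by blast
next
  case False
  then have card: "card A = card B" using le by simp
  have "\<not> A \<subseteq> B"
    using card_subset_eq[OF finite_indep[OF B]] card \<open>A \<noteq> B\<close> by auto
  then obtain a where a: "a \<in> A - B" by auto
  from symmetric_exchange[OF A B card a] obtain b where
    b: "b \<in> B - A" "insert b (A - {a}) \<in> \<I>" "insert a (B - {b}) \<in> \<I>" by blast
  have "{A, B} = {insert b (A - {a}), insert a (B - {b})}"
    using a b by (intro uniq) auto
  then have Beq: "B = insert b (A - {a})" using b by (auto simp: doubleton_eq_iff)
  \<comment> \<open>This set is \<open>A \<union> B\<close>; were it independent, it would form with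
    \<open>A \<inter> B = A - {a}\<close> a second decomposition.\<close>
  have "insert a (insert b (A - {a})) \<notin> \<I>"
  proof
    assume "insert a (insert b (A - {a})) \<in> \<I>"
    moreover have "A - {a} \<in> \<I>" using A indep_subset by blast
    ultimately have "{A, B} = {insert a (insert b (A - {a})), A - {a}}"
      using a b Beq by (intro uniq) auto
    then show False using a b by (auto simp: doubleton_eq_iff)
  qed
  then show thesis using a b Beq by (intro exchange[of a "A - {a}" b]) auto
qed

text \<open>Both sides are the sum of the indicators of the common union and the common
  intersection.\<close>

lemma indicator_vec_add_eqI:
  assumes "C \<union> D = A \<union> B" "C \<inter> D = A \<inter> B"
  shows "indicator_vec A + indicator_vec B = indicator_vec C + indicator_vec D"
proof -
  have "(i \<in> A \<or> i \<in> B) = (i \<in> C \<or> i \<in> D)" "(i \<in> A \<and> i \<in> B) = (i \<in> C \<and> i \<in> D)" for i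
    using assms by blast+
  then show ?thesis
    unfolding vec_eq_iff vector_add_component indicator_vec_nth by (smt (verit))
qed

lemma unique_decomposition_imp_edge:
  fixes \<I> :: "'x::finite set set"
  assumes "matroid UNIV \<I>"
    and A: "A \<in> \<I>" and B: "B \<in> \<I>" and "A \<noteq> B" and le: "card A \<le> card B"
    and uniq: "\<And>C D. C \<in> \<I> \<Longrightarrow> D \<in> \<I> \<Longrightarrow>
      indicator_vec A + indicator_vec B = indicator_vec C + indicator_vec D \<Longrightarrow> {A, B} = {C, D}"
  shows "closed_segment (indicator_vec A) (indicator_vec B) edge_of independence_polytope \<I>"
proof -
  interpret matroid UNIV \<I> by fact
  have "convex hull (indicator_vec ` {A, B}) face_of independence_polytope \<I>"
  proof (rule unique_decomposition_cases[OF A B \<open>A \<noteq> B\<close> le])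
    fix C D assume "C \<in> \<I>" "D \<in> \<I>" "C \<union> D = A \<union> B" "C \<inter> D = A \<inter> B"
    then show "{A, B} = {C, D}" using uniq indicator_vec_add_eqI by blast
  next
    fix b assume b: "b \<notin> A" "B = insert b A"
    \<comment> \<open>Nothing lies strictly between \<open>A\<close> and \<open>insert b A\<close>,
      so the interval face is the segment itself.\<close>
    then have "{C \<in> \<I>. A \<subseteq> C \<and> C \<subseteq> B} = {A, B}" using A B by auto
    then show ?thesis using interval_face[of A B \<I>] b by (simp add: subset_insertI)
  next
    fix S a b
    assume "a \<notin> S" "b \<notin> S" "a \<noteq> b" "A = insert a S" "B = insert b S"
      "insert a (insert b S) \<notin> \<I>"
    then show ?thesis using A B exchange_face[of a S \<I> b] indep_subset by blast
  qed
  then show ?thesis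
    using \<open>A \<noteq> B\<close>
    by (simp add: edge_of_def segment_convex_hull aff_dim_convex_hull aff_dim_2 indicator_vec_eq_iff)
qed

theorem theorem6p2:
  fixes \<I> :: "'x::finite set set"
  assumes "matroid (UNIV :: 'x set) \<I>"
  shows "{v. v extreme_point_of independence_polytope \<I>} = indicator_vec ` \<I> \<and>
    (\<forall>A\<in>\<I>. \<forall>B\<in>\<I>. indicator_vec A \<noteq> indicator_vec B \<longrightarrow>
       (closed_segment (indicator_vec A) (indicator_vec B) edge_of independence_polytope \<I>
        \<longleftrightarrow>
        (\<forall>C\<in>\<I>. \<forall>D\<in>\<I>. indicator_vec A + indicator_vec B = indicator_vec C + indicator_vec D
            \<longrightarrow> {A, B} = {C, D})))"
proof (intro conjI ballI impI iffI)
  show "{v. v extreme_point_of independence_polytope \<I>} = indicator_vec ` \<I>"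
    by (rule extreme_points_independence_polytope)
next
  fix A B C D
  assume "closed_segment (indicator_vec A) (indicator_vec B) edge_of independence_polytope \<I>"
    "C \<in> \<I>" "D \<in> \<I>" "indicator_vec A + indicator_vec B = indicator_vec C + indicator_vec D"
  then show "{A, B} = {C, D}" by (rule edge_imp_unique_decomposition)
next
  fix A B
  assume AB: "A \<in> \<I>" "B \<in> \<I>" "indicator_vec A \<noteq> indicator_vec B"
    and uniq: "\<forall>C\<in>\<I>. \<forall>D\<in>\<I>. indicator_vec A + indicator_vec B = indicator_vec C + indicator_vec D
      \<longrightarrow> {A, B} = {C, D}"
  show "closed_segment (indicator_vec A) (indicator_vec B) edge_of independence_polytope \<I>"
  proof (cases "card A \<le> card B")
    case True
    then show ?thesis
      using unique_decomposition_imp_edge[OF assms, of A B] AB uniq by blast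
  next
    case False
    \<comment> \<open>Edges and decompositions are symmetric in \<open>A\<close> and
      \<open>B\<close>, so the smaller set can be taken first.\<close>
    have "{B, A} = {C, D}" if "C \<in> \<I>" "D \<in> \<I>"
      "indicator_vec B + indicator_vec A = indicator_vec C + indicator_vec D" for C D
      using uniq that by (metis add.commute insert_commute)
    then have "closed_segment (indicator_vec B) (indicator_vec A) edge_of independence_polytope \<I>"
      using unique_decomposition_imp_edge[OF assms, of B A] AB False by fastforce
    then show ?thesis by (subst closed_segment_commute)
  qed
qed

end
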